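(* Let $G$ be a compact Hausdorff topological group, and let $X$ be a distributive binary $G$-space (with $X$ Hausdorff). Then the orbit projection $\pi : X \to X|G$ is (a) a closed map; (b) a proper map.
   Context: A binary action of a topological group $G$ on a topological space $X$ is a continuous map $\alpha : G\times X^2\to X$, written $g(x,x')=\alpha(g,x,x')$, such that $gh(x,x')=g(x,h(x,x'))$ and $e(x,x')=x'$ for all $g,h\in G$, $x,x'\in X$, where $e$ is the identity of $G$ and $gh(x,x')$ means $(gh)(x,x')$. A space $X$ with a fixed binary action of $G$ is called a binary $G$-space. A binary $G$-space is distributive if $g(h(x,x'),h(x,x''))=h(x,g(x',x''))$ for all $x,x',x''\in X$ and $g,h\in G$. A subset $A\subset X$ is bi-invariant if $\{g(a,b) : g\in G,\ a,b\in A\}=A$. The orbit $[x]$ of $x\in X$ is the minimal bi-invariant subset of $X$ containing $x$. In a distributive binary $G$-space, $[x]=G(x,x)=\{g(x,x): g\in G\}$, and the orbits partition $X$. The orbit space $X|G$ is the set of orbits with the quotient topology, and the orbit projection $\pi:X\to X|G$ takes each point to its orbit. A continuous map is proper if the preimage of every compact subset is compact. *)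

theory Defs
  imports "HOL-Analysis.Analysis" "HOL-Algebra.Group"
begin

locale topological_group = group G for G :: "('g, 'm) monoid_scheme" (structure) +
  fixes T :: "'g topology"
  assumes topspace_eq_carrier: "topspace T = carrier G"
    and continuous_mult: "continuous_map (prod_topology T T) T (\<lambda>(g, h). g \<otimes> h)"
    and continuous_inv: "continuous_map T T (\<lambda>g. inv g)"

text \<open>\<open>\<alpha> g x x'\<close> stands for \<open>g(x, x')\<close>.\<close>

locale binary_G_space = topological_group G T
  for G :: "('g, 'm) monoid_scheme" (structure) and T :: "'g topology" +
  fixes X :: "'x topology" and \<alpha> :: "'g \<Rightarrow> 'x \<Rightarrow> 'x \<Rightarrow> 'x"
  assumes continuous_action:
      "continuous_map (prod_topology T (prod_topology X X)) X (\<lambda>(g, x, x'). \<alpha> g x x')"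
    and action_mult:
      "\<lbrakk>g \<in> carrier G; h \<in> carrier G; x \<in> topspace X; x' \<in> topspace X\<rbrakk>
        \<Longrightarrow> \<alpha> (g \<otimes> h) x x' = \<alpha> g x (\<alpha> h x x')"
    and action_one: "\<lbrakk>x \<in> topspace X; x' \<in> topspace X\<rbrakk> \<Longrightarrow> \<alpha> \<one> x x' = x'"

locale distributive_binary_G_space = binary_G_space +
  assumes distributive:
    "\<lbrakk>g \<in> carrier G; h \<in> carrier G; x \<in> topspace X; x' \<in> topspace X; x'' \<in> topspace X\<rbrakk>
      \<Longrightarrow> \<alpha> g (\<alpha> h x x') (\<alpha> h x x'') = \<alpha> h x (\<alpha> g x' x'')"

definition bi_invariant ::
    "('g, 'm) monoid_scheme \<Rightarrow> 'x topology \<Rightarrow> ('g \<Rightarrow> 'x \<Rightarrow> 'x \<Rightarrow> 'x) \<Rightarrow> 'x set \<Rightarrow> bool"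
  where "bi_invariant G X \<alpha> A \<longleftrightarrow>
    A \<subseteq> topspace X \<and> {\<alpha> g a b |g a b. g \<in> carrier G \<and> a \<in> A \<and> b \<in> A} = A"

text \<open>The minimal bi-invariant set containing \<open>x\<close> is rendered as an intersection; by the two
  lemmas below it is the least such set.\<close>

definition binary_orbit ::
    "('g, 'm) monoid_scheme \<Rightarrow> 'x topology \<Rightarrow> ('g \<Rightarrow> 'x \<Rightarrow> 'x \<Rightarrow> 'x) \<Rightarrow> 'x \<Rightarrow> 'x set"
  where "binary_orbit G X \<alpha> x = \<Inter>{A. bi_invariant G X \<alpha> A \<and> x \<in> A}"

lemma (in binary_G_space) action_closed:
  assumes "g \<in> carrier G" "x \<in> topspace X" "x' \<in> topspace X"
  shows "\<alpha> g x x' \<in> topspace X"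
  using continuous_map_image_subset_topspace[OF continuous_action] assms topspace_eq_carrier
  by (force simp: image_subset_iff)

lemma (in binary_G_space) bi_invariant_binary_orbit:
  assumes "x \<in> topspace X"
  shows "bi_invariant G X \<alpha> (binary_orbit G X \<alpha> x)" "x \<in> binary_orbit G X \<alpha> x"
proof -
  let ?O = "binary_orbit G X \<alpha> x"
  have act: "\<alpha> g a b \<in> A" if "bi_invariant G X \<alpha> A" "g \<in> carrier G" "a \<in> A" "b \<in> A" for g a b A
    using that unfolding bi_invariant_def by blast
  have one: "b \<in> {\<alpha> g a b |g a b. g \<in> carrier G \<and> a \<in> A \<and> b \<in> A}"
    if "b \<in> A" "A \<subseteq> topspace X" for b A
  proof -
    have "b = \<alpha> \<one> b b" using that action_one by (metis subsetD)
    then show ?thesis using that one_closed by blast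
  qed
  have "bi_invariant G X \<alpha> (topspace X)"
    unfolding bi_invariant_def using action_closed one[of _ "topspace X"] by blast
  then have sub: "?O \<subseteq> topspace X"
    using assms unfolding binary_orbit_def by blast
  have "\<alpha> g a b \<in> ?O" if "g \<in> carrier G" "a \<in> ?O" "b \<in> ?O" for g a b
    using that act unfolding binary_orbit_def by blast
  then show "bi_invariant G X \<alpha> ?O"
    unfolding bi_invariant_def using sub one[of _ ?O] by blast
  show "x \<in> ?O" unfolding binary_orbit_def by blast
qed

lemma binary_orbit_least: "\<lbrakk>bi_invariant G X \<alpha> A; x \<in> A\<rbrakk> \<Longrightarrow> binary_orbit G X \<alpha> x \<subseteq> A"
  unfolding binary_orbit_def by blast

definition orbit_space ::
    "('g, 'm) monoid_scheme \<Rightarrow> 'x topology \<Rightarrow> ('g \<Rightarrow> 'x \<Rightarrow> 'x \<Rightarrow> 'x) \<Rightarrow> 'x set topology"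
  where "orbit_space G X \<alpha> = topology (\<lambda>U.
    U \<subseteq> binary_orbit G X \<alpha> ` topspace X \<and>
    openin X {x \<in> topspace X. binary_orbit G X \<alpha> x \<in> U})"

lemma openin_orbit_space:
  "openin (orbit_space G X \<alpha>) U \<longleftrightarrow>
    U \<subseteq> binary_orbit G X \<alpha> ` topspace X \<and> openin X {x \<in> topspace X. binary_orbit G X \<alpha> x \<in> U}"
proof -
  let ?p = "binary_orbit G X \<alpha>"
  let ?L = "\<lambda>U. U \<subseteq> ?p ` topspace X \<and> openin X {x \<in> topspace X. ?p x \<in> U}"
  have "?L (S \<inter> S')" if "?L S" "?L S'" for S S'
  proof -
    have "{x \<in> topspace X. ?p x \<in> S \<inter> S'} =
        {x \<in> topspace X. ?p x \<in> S} \<inter> {x \<in> topspace X. ?p x \<in> S'}" by blast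
    then show ?thesis using that by (auto intro: openin_Int)
  qed
  moreover have "?L (\<Union>\<K>)" if "\<forall>K\<in>\<K>. ?L K" for \<K>
  proof -
    have "{x \<in> topspace X. ?p x \<in> \<Union>\<K>} = (\<Union>K\<in>\<K>. {x \<in> topspace X. ?p x \<in> K})" by blast
    then show ?thesis using that by (auto intro!: openin_Union)
  qed
  ultimately have "istopology ?L" unfolding istopology_def by blast
  then show ?thesis unfolding orbit_space_def by (simp add: topology_inverse')
qed

lemma quotient_map_orbit_projection: "quotient_map X (orbit_space G X \<alpha>) (binary_orbit G X \<alpha>)"
proof -
  let ?p = "binary_orbit G X \<alpha>"
  have "{x \<in> topspace X. ?p x \<in> ?p ` topspace X} = topspace X" by blast
  then have "openin (orbit_space G X \<alpha>) (?p ` topspace X)"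
    by (simp add: openin_orbit_space)
  moreover have "topspace (orbit_space G X \<alpha>) \<subseteq> ?p ` topspace X"
    using openin_topspace[of "orbit_space G X \<alpha>"] unfolding openin_orbit_space by blast
  ultimately have "topspace (orbit_space G X \<alpha>) = ?p ` topspace X"
    by (meson openin_subset subset_antisym)
  then show ?thesis by (auto simp: quotient_map_def openin_orbit_space)
qed

text \<open>The library's \<^const>\<open>proper_map\<close> means closed with compact fibres; here properness
  is continuity together with compactness of preimages of compact sets.\<close>

definition compact_proper_map :: "'a topology \<Rightarrow> 'b topology \<Rightarrow> ('a \<Rightarrow> 'b) \<Rightarrow> bool"
  where "compact_proper_map X Y f \<longleftrightarrow>
    continuous_map X Y f \<and> (\<forall>K. compactin Y K \<longrightarrow> compactin X {x \<in> topspace X. f x \<in> K})"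

end

theory Submission
  imports Defs
begin

text \<open>Distributivity gives \<open>k(g(x,x), h(x,x)) = (g k g\<^sup>-\<^sup>1 h)(x,x)\<close>, so \<open>[x] = G(x,x)\<close> and the
  orbits partition \<open>X\<close>. Hence the saturation of a closed set \<open>F\<close> is the projection to \<open>X\<close> of the
  closed set \<open>{(g,x). g(x,x) \<in> F}\<close>, which is closed since \<open>G\<close> is compact. The fibres are
  continuous images of \<open>G\<close>, so \<open>\<pi>\<close> is closed with compact fibres and therefore proper.\<close>

context distributive_binary_G_space
begin

text \<open>Distributivity needs both arguments in the form \<open>\<alpha> g x _\<close>. Factoring
  \<open>h\<close> through \<open>g\<close> brings the second one there, which is where
  \<open>inv g\<close> comes from. Once \<open>g\<close> is pulled out, every factor acts with first
  argument \<open>x\<close>, so they multiply in \<open>G\<close>.\<close>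

lemma action_diagonal:
  assumes "k \<in> carrier G" "g \<in> carrier G" "h \<in> carrier G" "x \<in> topspace X"
  shows "\<alpha> k (\<alpha> g x x) (\<alpha> h x x) = \<alpha> (g \<otimes> k \<otimes> inv g \<otimes> h) x x"
proof -
  let ?y = "\<alpha> (inv g \<otimes> h) x x"
  have y: "?y \<in> topspace X" using assms by (simp add: action_closed)
  have "h = g \<otimes> (inv g \<otimes> h)" using assms by (simp flip: m_assoc)
  then have "\<alpha> h x x = \<alpha> g x ?y"
    using assms by (metis action_mult inv_closed m_closed)
  then have "\<alpha> k (\<alpha> g x x) (\<alpha> h x x) = \<alpha> g x (\<alpha> k x ?y)"
    using assms y by (simp add: distributive)
  also have "\<dots> = \<alpha> (g \<otimes> (k \<otimes> (inv g \<otimes> h))) x x"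
    using assms by (simp add: action_mult action_closed)
  finally show ?thesis using assms by (simp add: m_assoc)
qed

text \<open>By \<open>action_diagonal\<close> the right-hand side is closed under the action, so
  minimality bounds the orbit by it; the converse inclusion is bi-invariance of the orbit.\<close>

lemma binary_orbit_eq:
  assumes x: "x \<in> topspace X"
  shows "binary_orbit G X \<alpha> x = (\<lambda>g. \<alpha> g x x) ` carrier G"
proof
  let ?O = "(\<lambda>g. \<alpha> g x x) ` carrier G"
  have xO: "x \<in> ?O" using x action_one by force
  have sub: "?O \<subseteq> topspace X" using x action_closed by blast
  have "\<alpha> k a b \<in> ?O" if "k \<in> carrier G" "a \<in> ?O" "b \<in> ?O" for k a b
    using that x by (auto simp: action_diagonal)
  then have "{\<alpha> k a b |k a b. k \<in> carrier G \<and> a \<in> ?O \<and> b \<in> ?O} \<subseteq> ?O"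
    by auto
  \<comment> \<open>Bi-invariance is an equality of sets, so every point must also be attained;
    \<open>\<one>\<close> does this.\<close>
  moreover have "c \<in> {\<alpha> k a b |k a b. k \<in> carrier G \<and> a \<in> ?O \<and> b \<in> ?O}" if "c \<in> ?O" for c
  proof -
    have "c = \<alpha> \<one> c c" using that sub action_one by (metis subsetD)
    then show ?thesis using that by (metis (mono_tags, lifting) mem_Collect_eq one_closed)
  qed
  ultimately have "bi_invariant G X \<alpha> ?O"
    unfolding bi_invariant_def using sub by (meson subsetI subset_antisym)
  then show "binary_orbit G X \<alpha> x \<subseteq> ?O" using xO by (rule binary_orbit_least)
  show "?O \<subseteq> binary_orbit G X \<alpha> x"
  proof (rule image_subsetI)
    fix g assume "g \<in> carrier G"
    then have "\<alpha> g x x \<in> {\<alpha> g a b |g a b. g \<in> carrier G \<and>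
        a \<in> binary_orbit G X \<alpha> x \<and> b \<in> binary_orbit G X \<alpha> x}"
      using bi_invariant_binary_orbit(2)[OF x] by auto
    then show "\<alpha> g x x \<in> binary_orbit G X \<alpha> x"
      by (rule bi_invariant_binary_orbit(1)[OF x, unfolded bi_invariant_def,
            THEN conjunct2, THEN equalityD1, THEN subsetD])
  qed
qed

lemma binary_orbit_subset_topspace:
  assumes "x \<in> topspace X"
  shows "binary_orbit G X \<alpha> x \<subseteq> topspace X"
  using bi_invariant_binary_orbit(1)[OF assms] by (simp add: bi_invariant_def)

lemma binary_orbit_subset:
  assumes "x \<in> topspace X" "y \<in> binary_orbit G X \<alpha> x"
  shows "binary_orbit G X \<alpha> y \<subseteq> binary_orbit G X \<alpha> x"
  using bi_invariant_binary_orbit(1)[OF assms(1)] assms(2) by (rule binary_orbit_least)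

text \<open>This is the partition into orbits. One inclusion is minimality; the other needs
  symmetry, obtained by undoing \<open>g\<close> with \<open>inv g\<close>.\<close>

lemma binary_orbit_eq_iff:
  assumes x: "x \<in> topspace X" and y: "y \<in> topspace X"
  shows "binary_orbit G X \<alpha> x = binary_orbit G X \<alpha> y \<longleftrightarrow> y \<in> binary_orbit G X \<alpha> x"
proof
  assume "binary_orbit G X \<alpha> x = binary_orbit G X \<alpha> y"
  then show "y \<in> binary_orbit G X \<alpha> x" using y bi_invariant_binary_orbit(2) by blast
next
  assume yx: "y \<in> binary_orbit G X \<alpha> x"
  then obtain g where g: "g \<in> carrier G" "y = \<alpha> g x x"
    using x binary_orbit_eq by auto
  \<comment> \<open>Take \<open>k = inv g\<close> and \<open>h = g\<close> in
    \<open>action_diagonal\<close>: the product of the four group elements collapses to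
    \<open>\<one>\<close>.\<close>
  have "\<alpha> (inv g) y y = \<alpha> \<one> x x"
    using g x by (simp add: action_diagonal)
  then have "x = \<alpha> (inv g) y y" using x by (simp add: action_one)
  then have "x \<in> binary_orbit G X \<alpha> y"
    using g y binary_orbit_eq by auto
  then show "binary_orbit G X \<alpha> x = binary_orbit G X \<alpha> y"
    using binary_orbit_subset x y yx by (meson subset_antisym)
qed

lemma continuous_map_diagonal_action:
  "continuous_map (prod_topology T X) X (\<lambda>(g, x). \<alpha> g x x)"
proof -
  have "continuous_map (prod_topology T X) (prod_topology T (prod_topology X X))
      (\<lambda>p. (fst p, snd p, snd p))"
    by (simp add: continuous_map_pairedI continuous_map_fst continuous_map_snd)
  from continuous_map_compose[OF this continuous_action] show ?thesis
    by (simp add: o_def case_prod_unfold)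
qed

lemma compactin_binary_orbit:
  assumes "compact_space T" "x \<in> topspace X"
  shows "compactin X (binary_orbit G X \<alpha> x)"
proof -
  have "continuous_map T (prod_topology T X) (\<lambda>g. (g, x))"
    using assms(2) by (simp add: continuous_map_pairedI)
  from continuous_map_compose[OF this continuous_map_diagonal_action]
  have "continuous_map T X (\<lambda>g. \<alpha> g x x)" by (simp add: o_def)
  then show ?thesis
    using assms image_compactin[of T "topspace T"]
    by (simp add: binary_orbit_eq compact_space_def flip: topspace_eq_carrier)
qed

lemma closed_map_orbit_projection:
  assumes "compact_space T"
  shows "closed_map X (orbit_space G X \<alpha>) (binary_orbit G X \<alpha>)"
  unfolding closed_map_def
proof (intro allI impI)
  fix F assume F: "closedin X F"
  let ?\<pi> = "binary_orbit G X \<alpha>"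
  let ?Z = "{p \<in> topspace (prod_topology T X). (\<lambda>(g, x). \<alpha> g x x) p \<in> F}"
  have FX: "F \<subseteq> topspace X" using F by (rule closedin_subset)
  \<comment> \<open>Orbits partition the space, so \<open>x\<close> lies in the saturation of
    \<open>F\<close> exactly when its orbit meets \<open>F\<close>.\<close>
  have "{x \<in> topspace X. ?\<pi> x \<in> ?\<pi> ` F} = {x \<in> topspace X. \<exists>y\<in>F. y \<in> ?\<pi> x}"
    using FX binary_orbit_eq_iff by blast
  also have "\<dots> = snd ` ?Z"
    by (force simp: binary_orbit_eq topspace_eq_carrier)
  finally have sat: "{x \<in> topspace X. ?\<pi> x \<in> ?\<pi> ` F} = snd ` ?Z" .
  have "closedin (prod_topology T X) ?Z"
    using continuous_map_diagonal_action F by (rule closedin_continuous_map_preimage)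
  \<comment> \<open>Compactness of \<open>T\<close> enters here: projection along a compact factor
    is a closed map.\<close>
  then have "closedin X (snd ` ?Z)"
    using closed_map_snd[OF assms, of X] unfolding closed_map_def by blast
  moreover have "?\<pi> ` F \<subseteq> topspace (orbit_space G X \<alpha>)"
    using FX quotient_imp_surjective_map[OF quotient_map_orbit_projection[of X G \<alpha>]] by blast
  \<comment> \<open>A quotient map detects closedness on preimages, and the preimage in question is
    the saturation \<open>sat\<close>.\<close>
  ultimately show "closedin (orbit_space G X \<alpha>) (?\<pi> ` F)"
    using quotient_map_orbit_projection[of X G \<alpha>] sat unfolding quotient_map_closedin
    by metis
qed

lemma proper_map_orbit_projection:
  assumes "compact_space T"
  shows "proper_map X (orbit_space G X \<alpha>) (binary_orbit G X \<alpha>)"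
  unfolding proper_map_def
proof (intro conjI ballI)
  show "closed_map X (orbit_space G X \<alpha>) (binary_orbit G X \<alpha>)"
    using assms by (rule closed_map_orbit_projection)
  fix y assume "y \<in> topspace (orbit_space G X \<alpha>)"
  then obtain x where x: "x \<in> topspace X" "y = binary_orbit G X \<alpha> x"
    using quotient_imp_surjective_map[OF quotient_map_orbit_projection[of X G \<alpha>]] by auto
  \<comment> \<open>The fibre over an orbit is that orbit itself, viewed as a subset of
    \<open>X\<close>.\<close>
  then have "{z \<in> topspace X. binary_orbit G X \<alpha> z = y} = binary_orbit G X \<alpha> x"
    using binary_orbit_eq_iff[OF x(1)] binary_orbit_subset_topspace[OF x(1)] by auto
  then show "compactin X {z \<in> topspace X. binary_orbit G X \<alpha> z = y}"
    using compactin_binary_orbit[OF assms x(1)] by simp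
qed

end

theorem theorem4:
  fixes G :: "('g, 'm) monoid_scheme" and T :: "'g topology"
    and X :: "'x topology" and \<alpha> :: "'g \<Rightarrow> 'x \<Rightarrow> 'x \<Rightarrow> 'x"
  assumes "distributive_binary_G_space G T X \<alpha>"
    and "compact_space T" and "Hausdorff_space T"
    and "Hausdorff_space X"
  shows "closed_map X (orbit_space G X \<alpha>) (binary_orbit G X \<alpha>)
    \<and> compact_proper_map X (orbit_space G X \<alpha>) (binary_orbit G X \<alpha>)"
proof -
  interpret distributive_binary_G_space G T X \<alpha> by fact
  \<comment> \<open>Closedness with compact fibres yields compact preimages of compact sets, which
    is the form that \<open>compact_proper_map\<close> asks for.\<close>
  note proper = proper_map_orbit_projection[OF \<open>compact_space T\<close>]
  show ?thesis
    unfolding compact_proper_map_def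
    using closed_map_orbit_projection[OF \<open>compact_space T\<close>]
      quotient_imp_continuous_map[OF quotient_map_orbit_projection]
      compactin_proper_map_preimage[OF proper] by blast
qed

end
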